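(* Let $\alpha\in\mathbb{R}$ be fixed with $0<\alpha<1$, and let $r$ range over real values. Then, as $r\to\infty$ (that is, $r\to+\infty$), $$\binom{r}{r\alpha}\sim\sqrt{\frac{1}{2\pi\alpha(1-\alpha)r}}\,\Bigl(\frac{1}{\alpha}\Bigr)^{\alpha r}\Bigl(\frac{1}{1-\alpha}\Bigr)^{(1-\alpha)r}.$$
   Context: $\Gamma$ denotes Euler's gamma function. For real $r\in(-1,+\infty)$ and $\beta\in(-1,r+1)$ the binomial coefficient of real arguments is defined by $\binom{r}{\beta}=\frac{\Gamma(1+r)}{\Gamma(1+\beta)\,\Gamma(1+r-\beta)}$. For real-valued functions positive in a neighborhood of $\infty$, $f(x)\sim g(x)$ as $x\to\infty$ means $\lim_{x\to\infty}f(x)/g(x)=1$. *)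

theory Defs
  imports "HOL-Analysis.Analysis" "HOL-Library.Landau_Symbols"
begin

text \<open>
  The binomial coefficient of real arguments. The intended domain is \<open>-1 < r\<close> and
  \<open>-1 < \<beta> < r + 1\<close>, where all three Gamma arguments are positive; values outside it
  carry no meaning. The library's \<open>gchoose\<close> only admits a natural number as lower argument.
\<close>
definition real_binomial :: "real \<Rightarrow> real \<Rightarrow> real" where
  "real_binomial r \<beta> = Gamma (1 + r) / (Gamma (1 + \<beta>) * Gamma (1 + r - \<beta>))"

end

theory Submission
  imports Defs "HOL-Real_Asymp.Real_Asymp"
begin

text \<open>
  The binomial coefficient is a quotient of Gamma values, so everything follows from Stirling's
  formula for real arguments, \<open>\<Gamma>(1 + x) \<sim> \<surd>(2\<pi>x) x\<^sup>x e\<^sup>-\<^sup>x\<close>. Inserting it for each of the three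
  Gamma factors and using \<open>\<alpha> + (1 - \<alpha>) = 1\<close>, the factors \<open>r\<^sup>r\<close> and \<open>e\<^sup>-\<^sup>r\<close> cancel,
  and what remains is the claimed expression, exactly and not only asymptotically
  (\<open>stirling_quotient\<close>).

  Stirling's formula is proved through the function
  \<open>h(x) = ln \<Gamma>(x) - (x - 1/2) ln x + x\<close>, called \<open>stirling_error\<close>. By the functional equation of
  \<open>\<Gamma>\<close>, \<open>h(x) - h(x + 1)\<close> is the elementary expression \<open>(x + 1/2) ln (1 + 1/x) - 1\<close>, which lies
  between \<open>0\<close> and \<open>1/x - 1/(x + 1)\<close>. Telescoping shows that \<open>h\<close> varies by at most \<open>1/x\<close> along
  \<open>x, x + 1, x + 2, \<dots>\<close>. Gauss's product limit for \<open>\<Gamma>\<close> shows that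
  \<open>h(x + n) - h(n) \<longlonglongrightarrow> 0\<close> for each fixed \<open>x\<close>, so that the progressions starting at different points
  share one limit. Together this gives \<open>h(x) - h(y) \<le> 1/x\<close> for all positive \<open>x\<close> and \<open>y\<close>,
  so \<open>h\<close> converges at infinity. Its limit \<open>L\<close> is read off from Legendre's duplication formula,
  where \<open>h(x) + h(x + 1/2) - h(2x)\<close> is elementary and tends both to \<open>L\<close> and to \<open>ln (2\<pi>) / 2\<close>.
\<close>

section \<open>Convergence of the error term in Stirling's formula\<close>

lemma pos_real_not_nonpos_Int: "x > (0::real) \<Longrightarrow> x \<notin> \<int>\<^sub>\<le>\<^sub>0"
  by (auto elim!: nonpos_Ints_cases)

text \<open>
  The constant \<open>ln (2\<pi>) / 2\<close> is not subtracted: its value only emerges at the end, as the limit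
  at infinity.
\<close>
definition stirling_error :: "real \<Rightarrow> real" where
  "stirling_error x = ln (Gamma x) - (x - 1/2) * ln x + x"

lemma stirling_error_step:
  assumes "x > 0"
  shows "stirling_error x - stirling_error (x + 1) = (x + 1/2) * (ln (x + 1) - ln x) - 1"
proof -
  have "x \<notin> \<int>\<^sub>\<le>\<^sub>0"
    using assms by (rule pos_real_not_nonpos_Int)
  hence "Gamma (x + 1) = x * Gamma x"
    by (rule Gamma_plus1)
  hence "ln (Gamma (x + 1)) = ln x + ln (Gamma x)"
    using assms by (simp add: ln_mult_pos)
  thus ?thesis
    unfolding stirling_error_def by (simp add: algebra_simps)
qed

text \<open>
  The two bounds are the midpoint and the trapezoidal estimate for the integral of \<open>1/t\<close> over
  \<open>[x, x + 1]\<close>. The trapezoidal estimate even gives a quarter of \<open>1/x - 1/(x + 1)\<close>; what matters is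
  that the bound telescopes.
\<close>
lemma stirling_error_step_bounds:
  assumes "x > 0"
  shows "stirling_error (x + 1) \<le> stirling_error x"
    and "stirling_error x - 1 / x \<le> stirling_error (x + 1) - 1 / (x + 1)"
proof -
  have "(x + 1/2) * (2 * ((x + 1) - x) / (x + (x + 1))) \<le> (x + 1/2) * (ln (x + 1) - ln x)"
    using assms ln_inverse_approx_ge[of x "x + 1"] by (intro mult_left_mono) auto
  moreover have "(x + 1/2) * (2 * ((x + 1) - x) / (x + (x + 1))) = 1"
    using assms by (simp add: field_simps)
  ultimately show "stirling_error (x + 1) \<le> stirling_error x"
    using stirling_error_step[OF assms] by linarith
  have "(x + 1/2) * (ln (x + 1) - ln x) \<le> (x + 1/2) * (1 * (inverse x + inverse (x + 1)) / 2)"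
    using assms ln_inverse_approx_le[of x 1] by (intro mult_left_mono) auto
  also have "\<dots> = 1 + (1 / x - 1 / (x + 1)) / 4"
    using assms by (simp add: divide_simps) (simp add: algebra_simps)
  also have "\<dots> \<le> 1 + (1 / x - 1 / (x + 1))"
  proof -
    have "1 / (x + 1) \<le> 1 / x"
      using assms by (intro divide_left_mono) auto
    thus ?thesis by simp
  qed
  finally show "stirling_error x - 1 / x \<le> stirling_error (x + 1) - 1 / (x + 1)"
    using stirling_error_step[OF assms] by linarith
qed

lemma stirling_error_shift_bounds:
  assumes "x > 0"
  shows "stirling_error (x + real n) \<le> stirling_error x"
    and "stirling_error x - 1 / x \<le> stirling_error (x + real n)"
proof -
  have "stirling_error (x + real n) \<le> stirling_error x \<and>
        stirling_error x - 1 / x \<le> stirling_error (x + real n) - 1 / (x + real n)"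
  proof (induction n)
    case (Suc n)
    have "x + real (Suc n) = (x + real n) + 1" "x + real n > 0"
      using assms by auto
    thus ?case
      using Suc stirling_error_step_bounds[of "x + real n"] by (metis order_trans)
  qed auto
  moreover have "1 / (x + real n) \<ge> 0"
    using assms by simp
  ultimately show "stirling_error (x + real n) \<le> stirling_error x"
    and "stirling_error x - 1 / x \<le> stirling_error (x + real n)"
    by linarith+
qed

text \<open>
  Gauss's limit \<open>\<Gamma>(x) = lim (n - 1)! n\<^sup>x / (x (x + 1) \<dots> (x + n - 1))\<close> in logarithmic form:
  the factorial is \<open>\<Gamma>(n)\<close> and the denominator is \<open>\<Gamma>(x + n) / \<Gamma>(x)\<close>.
\<close>
lemma ln_Gamma_shift_asymptotics:
  assumes "x > (0::real)"
  shows "(\<lambda>n. ln (Gamma (x + real n)) - ln (Gamma (real n)) - x * ln (real n)) \<longlonglongrightarrow> 0"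
proof -
  have x: "x \<notin> \<int>\<^sub>\<le>\<^sub>0"
    using assms by (rule pos_real_not_nonpos_Int)
  have "(\<lambda>n. ln (Gamma_series' x n)) \<longlonglongrightarrow> ln (Gamma x)"
    by (rule tendsto_ln[OF Gamma_series'_LIMSEQ Gamma_nonzero[OF x]])
  hence "(\<lambda>n. ln (Gamma x) - ln (Gamma_series' x n)) \<longlonglongrightarrow> ln (Gamma x) - ln (Gamma x)"
    by (intro tendsto_diff tendsto_const)
  moreover have "\<forall>\<^sub>F n in sequentially. ln (Gamma x) - ln (Gamma_series' x n) =
                   ln (Gamma (x + real n)) - ln (Gamma (real n)) - x * ln (real n)"
    using eventually_gt_at_top[of 0]
  proof eventually_elim
    case (elim n)
    have fact: "fact (n - 1) = Gamma (real n)"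
      using Gamma_fact[of "n - 1", where ?'a = real] elim by (simp add: of_nat_diff)
    have "Gamma_series' x n = Gamma (real n) * exp (x * ln (real n)) / (Gamma (x + real n) / Gamma x)"
      unfolding Gamma_series'_def fact pochhammer_Gamma[OF x] by simp
    moreover have "Gamma x > 0" "Gamma (real n) > 0" "Gamma (x + real n) > 0"
      using assms elim by simp_all
    ultimately show ?case
      by (simp add: ln_mult_pos ln_div)
  qed
  ultimately show ?thesis
    by (simp add: tendsto_cong)
qed

lemma stirling_error_shift_tendsto:
  assumes "x > 0"
  shows "(\<lambda>n. stirling_error (x + real n) - stirling_error (real n)) \<longlonglongrightarrow> 0"
proof -
  have "(\<lambda>n. (x + real n - 1/2) * ln (x + real n) - (real n - 1/2) * ln (real n)
              - x - x * ln (real n)) \<longlonglongrightarrow> 0"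
    by real_asymp
  from tendsto_diff[OF ln_Gamma_shift_asymptotics[OF assms] this] show ?thesis
    by (simp add: stirling_error_def algebra_simps)
qed

text \<open>
  Both points are moved by the same large \<open>n\<close>, which makes their values agree in the limit;
  moving \<open>x\<close> costs at most \<open>1/x\<close>, and moving \<open>y\<close> only decreases the value there.
\<close>
lemma stirling_error_diff_le:
  assumes "x > 0" "y > 0"
  shows "stirling_error x - stirling_error y \<le> 1 / x"
proof -
  have "(\<lambda>n. (stirling_error (x + real n) - stirling_error (real n))
            - (stirling_error (y + real n) - stirling_error (real n))) \<longlonglongrightarrow> 0 - 0"
    by (intro tendsto_diff stirling_error_shift_tendsto assms)
  moreover have "(stirling_error (x + real n) - stirling_error (real n))
            - (stirling_error (y + real n) - stirling_error (real n))
            \<ge> stirling_error x - 1 / x - stirling_error y" for n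
    using stirling_error_shift_bounds[of x n] stirling_error_shift_bounds[of y n] assms by linarith
  ultimately have "stirling_error x - 1 / x - stirling_error y \<le> 0 - 0"
    by (intro tendsto_lowerbound) auto
  thus ?thesis by simp
qed

text \<open>The limit is the infimum, which the preceding lemma places within \<open>1/x\<close> below the value at \<open>x\<close>.\<close>
lemma stirling_error_convergent: "\<exists>L. (stirling_error \<longlongrightarrow> L) at_top"
proof -
  define L where "L = (INF y\<in>{0<..}. stirling_error y)"
  have bdd: "bdd_below (stirling_error ` {0<..})"
    using stirling_error_diff_le[of 1] by (intro bdd_belowI2[of _ "stirling_error 1 - 1"]) force
  have lower: "\<forall>\<^sub>F x in at_top. L \<le> stirling_error x"
    using eventually_gt_at_top[of 0]
    by eventually_elim (auto simp: L_def intro!: cINF_lower bdd)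
  have upper: "\<forall>\<^sub>F x in at_top. stirling_error x \<le> L + 1 / x"
    using eventually_gt_at_top[of 0]
  proof eventually_elim
    case (elim x)
    have "stirling_error x - 1 / x \<le> L"
      unfolding L_def using stirling_error_diff_le[OF elim]
      by (intro cINF_greatest) (auto simp: algebra_simps)
    thus ?case by simp
  qed
  have "((\<lambda>x. L + 1 / x) \<longlongrightarrow> L) at_top"
    by real_asymp
  from tendsto_sandwich[OF lower upper tendsto_const this] show ?thesis
    by blast
qed

section \<open>Stirling's formula for real arguments\<close>

lemma Gamma_legendre_duplication_real:
  assumes "x > (0::real)"
  shows "Gamma x * Gamma (x + 1/2) = exp ((1 - 2 * x) * ln 2) * sqrt pi * Gamma (2 * x)"
proof -
  have "complex_of_real y \<notin> \<int>\<^sub>\<le>\<^sub>0" if "y > 0" for y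
    using that by (simp add: of_real_in_nonpos_Ints_iff pos_real_not_nonpos_Int)
  from this[of x] this[of "x + 1/2"]
  have "complex_of_real x \<notin> \<int>\<^sub>\<le>\<^sub>0" "complex_of_real x + 1/2 \<notin> \<int>\<^sub>\<le>\<^sub>0"
    using assms by simp_all
  hence dup: "Gamma (complex_of_real x) * Gamma (complex_of_real x + 1/2) =
          exp ((1 - 2 * complex_of_real x) * of_real (ln 2)) * of_real (sqrt pi) * Gamma (2 * complex_of_real x)"
    by (rule Gamma_legendre_duplication)
  have eqs: "complex_of_real x + 1/2 = of_real (x + 1/2)" "2 * complex_of_real x = of_real (2 * x)"
       "(1 - complex_of_real (2 * x)) * of_real (ln 2) = of_real ((1 - 2 * x) * ln 2)"
    by simp_all
  have "complex_of_real (Gamma x * Gamma (x + 1/2)) =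
          of_real (exp ((1 - 2 * x) * ln 2) * sqrt pi * Gamma (2 * x))"
    using dup unfolding eqs Gamma_complex_of_real exp_of_real of_real_mult[symmetric] .
  thus ?thesis
    by (rule of_real_eq_iff[THEN iffD1])
qed

lemma stirling_error_tendsto: "(stirling_error \<longlongrightarrow> ln (2 * pi) / 2) at_top"
proof -
  obtain L where L: "(stirling_error \<longlongrightarrow> L) at_top"
    using stirling_error_convergent by blast
  have "((\<lambda>x. stirling_error x + stirling_error (x + 1/2) - stirling_error (2 * x)) \<longlongrightarrow> L + L - L) at_top"
    by (intro tendsto_intros L filterlim_compose[OF L]) real_asymp+
  moreover have "\<forall>\<^sub>F x in at_top. stirling_error x + stirling_error (x + 1/2) - stirling_error (2 * x) =
      (1 - 2 * x) * ln 2 + ln pi / 2 - (x - 1/2) * ln x - x * ln (x + 1/2) + (2 * x - 1/2) * ln (2 * x) + 1/2"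
    using eventually_gt_at_top[of 0]
  proof eventually_elim
    case (elim x)
    from Gamma_legendre_duplication_real[OF elim]
    have "ln (Gamma x * Gamma (x + 1/2)) = ln (exp ((1 - 2 * x) * ln 2) * sqrt pi * Gamma (2 * x))"
      by simp
    hence "ln (Gamma x) + ln (Gamma (x + 1/2)) = (1 - 2 * x) * ln 2 + ln pi / 2 + ln (Gamma (2 * x))"
      using elim by (simp add: ln_mult ln_sqrt less_imp_neq[symmetric])
    thus ?case
      unfolding stirling_error_def by (simp add: algebra_simps)
  qed
  ultimately have "((\<lambda>x. (1 - 2 * x) * ln 2 + ln pi / 2 - (x - 1/2) * ln x - x * ln (x + 1/2)
      + (2 * x - 1/2) * ln (2 * x) + 1/2) \<longlongrightarrow> L) at_top"
    by (simp add: tendsto_cong)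
  moreover have "((\<lambda>x::real. (1 - 2 * x) * ln 2 + ln pi / 2 - (x - 1/2) * ln x - x * ln (x + 1/2)
      + (2 * x - 1/2) * ln (2 * x) + 1/2) \<longlongrightarrow> (ln 2 + ln pi) / 2) at_top"
    by (real_asymp simp: algebra_simps)
  ultimately have "L = (ln 2 + ln pi) / 2"
    by (rule tendsto_unique[OF trivial_limit_at_top_linorder])
  also have "\<dots> = ln (2 * pi) / 2"
    by (simp add: ln_mult_pos)
  finally show ?thesis
    using L by blast
qed

definition stirling :: "real \<Rightarrow> real" where
  "stirling x = sqrt (2 * pi * x) * x powr x * exp (- x)"

lemma stirling_pos: "x > 0 \<Longrightarrow> stirling x > 0"
  by (simp add: stirling_def)

lemma ln_stirling:
  assumes "x > 0"
  shows "ln (stirling x) = (ln (2 * pi) + ln x) / 2 + x * ln x - x"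
proof -
  have "ln (stirling x) = ln (sqrt (2 * pi * x)) + ln (x powr x) + ln (exp (- x))"
    unfolding stirling_def using assms by (simp add: ln_mult_pos)
  moreover have "ln (sqrt (2 * pi * x)) = (ln (2 * pi) + ln x) / 2"
    using assms ln_mult_pos[of "2 * pi" x] by (simp add: ln_sqrt)
  ultimately show ?thesis
    by simp
qed

theorem Gamma_asymp_equiv_stirling: "(\<lambda>x::real. Gamma (1 + x)) \<sim>[at_top] stirling"
proof (rule asymp_equivI')
  have "((\<lambda>x. exp (stirling_error x - ln (2 * pi) / 2)) \<longlongrightarrow> exp (ln (2 * pi) / 2 - ln (2 * pi) / 2)) at_top"
    by (intro tendsto_intros stirling_error_tendsto)
  moreover have "\<forall>\<^sub>F x in at_top. exp (stirling_error x - ln (2 * pi) / 2) = Gamma (1 + x) / stirling x"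
    using eventually_gt_at_top[of 0]
  proof eventually_elim
    case (elim x)
    have "x \<notin> \<int>\<^sub>\<le>\<^sub>0"
      using elim by (rule pos_real_not_nonpos_Int)
    hence "Gamma (1 + x) = x * Gamma x"
      by (metis Gamma_plus1 add.commute)
    hence "ln (Gamma (1 + x)) = ln x + ln (Gamma x)"
      using elim by (simp add: ln_mult_pos)
    moreover have "ln (Gamma (1 + x) / stirling x) = ln (Gamma (1 + x)) - ln (stirling x)"
      using elim by (intro ln_divide_pos stirling_pos Gamma_real_pos) auto
    ultimately have "ln (Gamma (1 + x) / stirling x) = stirling_error x - ln (2 * pi) / 2"
      using elim by (simp add: ln_stirling stirling_error_def field_simps)
    moreover have "Gamma (1 + x) / stirling x > 0"
      using elim by (simp add: stirling_pos)
    ultimately show ?case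
      by (metis exp_ln)
  qed
  ultimately show "((\<lambda>x. Gamma (1 + x) / stirling x) \<longlongrightarrow> 1) at_top"
    by (simp add: tendsto_cong)
qed

section \<open>The binomial coefficient\<close>

text \<open>
  Compared through logarithms: the terms \<open>r ln r\<close> and \<open>r\<close> occur with the factor \<open>1 - (a + b)\<close>
  and vanish, and of the three half logarithms of \<open>2\<pi>r\<close> one survives with a minus sign.
\<close>
lemma stirling_quotient:
  assumes "r > 0" "a > 0" "b > 0" "a + b = 1"
  shows "stirling r / (stirling (r * a) * stirling (r * b)) =
           sqrt (1 / (2 * pi * a * b * r)) * (1 / a) powr (a * r) * (1 / b) powr (b * r)"
    (is "?lhs = ?rhs")
proof -
  have pos: "stirling r > 0" "stirling (r * a) > 0" "stirling (r * b) > 0"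
    using assms by (simp_all add: stirling_pos)
  have "ln ?lhs = ln (stirling r) - (ln (stirling (r * a)) + ln (stirling (r * b)))"
    using pos by (simp add: ln_divide_pos ln_mult_pos)
  also have "\<dots> = - (ln (2 * pi) + ln a + ln b + ln r) / 2 - a * r * ln a - b * r * ln b
                   + (1 - (a + b)) * (r * ln r - r)"
  proof -
    have "ln (stirling (r * c)) = (ln (2 * pi) + (ln r + ln c)) / 2 + r * c * (ln r + ln c) - r * c"
      if "c > 0" for c
      using assms that by (simp add: ln_stirling ln_mult_pos)
    from this[OF \<open>a > 0\<close>] this[OF \<open>b > 0\<close>] ln_stirling[OF \<open>r > 0\<close>] show ?thesis
      by (simp only:) (simp add: field_simps)
  qed
  also have "\<dots> = - (ln (2 * pi) + ln a + ln b + ln r) / 2 - a * r * ln a - b * r * ln b"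
    using assms by simp
  also have "\<dots> = ln ?rhs"
  proof -
    have "ln ?rhs = ln (sqrt (1 / (2 * pi * a * b * r))) + ln ((1 / a) powr (a * r))
                      + ln ((1 / b) powr (b * r))"
      using assms by (simp add: ln_mult_pos)
    moreover have "ln (sqrt (1 / (2 * pi * a * b * r))) = - ln (2 * pi * a * b * r) / 2"
      using assms ln_divide_pos[of 1 "2 * pi * a * b * r"] by (simp add: ln_sqrt)
    moreover have "ln (2 * pi * a * b * r) = ln (2 * pi) + ln a + ln b + ln r"
      using assms ln_mult_pos[of "2 * pi * a * b" r] ln_mult_pos[of "2 * pi * a" b]
        ln_mult_pos[of "2 * pi" a] by simp
    ultimately show ?thesis
      using assms by (simp add: ln_divide_pos)
  qed
  finally have "ln ?lhs = ln ?rhs" .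
  moreover have "?lhs > 0" "?rhs > 0"
    using assms pos by simp_all
  ultimately show ?thesis
    by (metis ln_inj_iff)
qed

theorem proposition1:
  fixes \<alpha> :: real
  assumes "0 < \<alpha>" and "\<alpha> < 1"
  shows "(\<lambda>r::real. real_binomial r (r * \<alpha>)) \<sim>[at_top]
         (\<lambda>r::real. sqrt (1 / (2 * pi * \<alpha> * (1 - \<alpha>) * r))
                     * (1 / \<alpha>) powr (\<alpha> * r) * (1 / (1 - \<alpha>)) powr ((1 - \<alpha>) * r))"
proof -
  have scale: "(\<lambda>r. Gamma (1 + r * c)) \<sim>[at_top] (\<lambda>r. stirling (r * c))" if "c > 0" for c :: real
  proof (rule asymp_equiv_compose'[OF Gamma_asymp_equiv_stirling])
    show "filterlim (\<lambda>r. r * c) at_top at_top"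
      using that by real_asymp
  qed
  have "(\<lambda>r. Gamma (1 + r) / (Gamma (1 + r * \<alpha>) * Gamma (1 + r * (1 - \<alpha>)))) \<sim>[at_top]
        (\<lambda>r. stirling r / (stirling (r * \<alpha>) * stirling (r * (1 - \<alpha>))))"
    using assms by (intro asymp_equiv_divide asymp_equiv_mult Gamma_asymp_equiv_stirling scale) auto
  also have "(\<lambda>r. Gamma (1 + r) / (Gamma (1 + r * \<alpha>) * Gamma (1 + r * (1 - \<alpha>)))) =
             (\<lambda>r. real_binomial r (r * \<alpha>))"
    by (rule ext) (simp add: real_binomial_def algebra_simps)
  finally show ?thesis
  proof (rule asymp_equiv_trans, intro asymp_equiv_refl_ev)
    show "\<forall>\<^sub>F r in at_top. stirling r / (stirling (r * \<alpha>) * stirling (r * (1 - \<alpha>))) =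
            sqrt (1 / (2 * pi * \<alpha> * (1 - \<alpha>) * r))
              * (1 / \<alpha>) powr (\<alpha> * r) * (1 / (1 - \<alpha>)) powr ((1 - \<alpha>) * r)"
      using eventually_gt_at_top[of 0] by eventually_elim (rule stirling_quotient; use assms in simp)
  qed
qed

end
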